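(* Let $(X,x_0)$ and $(Y,y_0)$ be discrete pointed metric spaces with bounded geometry, with $\operatorname{asdim} X=n$ and $\operatorname{asdim} Y\le n$, where $n>0$. Then $\operatorname{asdim}(X\hat{\ast}Y)=n$.
   Context: For a metric space $X$, $\operatorname{asdim} X\le n$ means: for every $D>0$ there exist families $\mathcal{U}_0,\ldots,\mathcal{U}_n$ of uniformly bounded subsets of $X$, each $D$-disjoint (distinct members are at distance $>D$), whose union covers $X$. $\operatorname{asdim}X$ is the smallest such $n$. A discrete metric space has bounded geometry if for every $r>0$ there is $N$ such that every ball of radius $r$ has at most $N$ elements. The metric space $X\hat{\ast}Y$ for pointed metric spaces $(X,x_0)$ and $(Y,y_0)$: its elements are the alternating words formed from the alphabet $(X\setminus\{x_0\})\sqcup(Y\setminus\{y_0\})$ (letters lie alternately in $X\setminus\{x_0\}$ and $Y\setminus\{y_0\}$), including the empty word $\tilde e$; one sets $x_0=y_0=\tilde e$. The norm is defined by $\|z\|=0$ if and only if $z=\tilde e$, and $\|x_1y_1\cdots x_ry_r\|=\sum_i \big(d_X(x_i,x_0)+d_Y(y_i,y_0)\big)$, where $x_1=x_0$ or $y_r=y_0$ is allowed. The metric: for words $z,z'$ write $z=uv$ and $z'=uv'$, where $u$ is the (longest) common beginning of $z$ and $z'$, possibly $\tilde e$; then $d(z,z')=\|v\|+\|v'\|$.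
   Formalization: The metric is corrected: if v and v' begin with distinct letters x, x' of the same factor, these contribute d(x,x') instead of d(x,x_0)+d(x',x_0). With the printed formula the claim is false: X = Z and Y a point give asymptotic dimension 0, not 1. *)

theory Defs
  imports "HOL-Analysis.Analysis" "HOL-Library.Sublist"
begin

section \<open>Asymptotic dimension and bounded geometry\<close>

text \<open>The distance between two subsets, an infimum; it is infinite if one of them is empty.\<close>

definition set_distance :: "('a \<Rightarrow> 'a \<Rightarrow> real) \<Rightarrow> 'a set \<Rightarrow> 'a set \<Rightarrow> ereal" where
  "set_distance d A B = (INF a\<in>A. INF b\<in>B. ereal (d a b))"

definition disjoint_family_by :: "('a \<Rightarrow> 'a \<Rightarrow> real) \<Rightarrow> real \<Rightarrow> 'a set set \<Rightarrow> bool" where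
  "disjoint_family_by d D \<U> \<longleftrightarrow>
     (\<forall>A\<in>\<U>. \<forall>B\<in>\<U>. A \<noteq> B \<longrightarrow> set_distance d A B > ereal D)"

definition uniformly_bounded_family :: "('a \<Rightarrow> 'a \<Rightarrow> real) \<Rightarrow> 'a set set \<Rightarrow> bool" where
  "uniformly_bounded_family d \<U> \<longleftrightarrow> (\<exists>R. \<forall>A\<in>\<U>. \<forall>a\<in>A. \<forall>b\<in>A. d a b \<le> R)"

definition asdim_le :: "'a set \<Rightarrow> ('a \<Rightarrow> 'a \<Rightarrow> real) \<Rightarrow> nat \<Rightarrow> bool" where
  "asdim_le M d n \<longleftrightarrow>
     (\<forall>D>0. \<exists>\<U> :: nat \<Rightarrow> 'a set set.
        (\<forall>i\<le>n. \<U> i \<subseteq> Pow M \<and> uniformly_bounded_family d (\<U> i) \<and>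
               disjoint_family_by d D (\<U> i)) \<and>
        M \<subseteq> (\<Union>i\<le>n. \<Union>(\<U> i)))"

text \<open>The value is \<open>\<infinity>\<close> if \<^const>\<open>asdim_le\<close> holds for no \<open>n\<close>.\<close>

definition asdim :: "'a set \<Rightarrow> ('a \<Rightarrow> 'a \<Rightarrow> real) \<Rightarrow> enat" where
  "asdim M d = Inf (enat ` {n. asdim_le M d n})"

definition discrete_metric_space :: "'a set \<Rightarrow> ('a \<Rightarrow> 'a \<Rightarrow> real) \<Rightarrow> bool" where
  "discrete_metric_space M d \<longleftrightarrow>
     Metric_space M d \<and> Metric_space.mtopology M d = discrete_topology M"

definition bounded_geometry :: "'a set \<Rightarrow> ('a \<Rightarrow> 'a \<Rightarrow> real) \<Rightarrow> bool" where
  "bounded_geometry M d \<longleftrightarrow>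
     (\<forall>r>0. \<exists>N::nat. \<forall>x\<in>M. finite (Metric_space.mball M d x r) \<and>
                             card (Metric_space.mball M d x r) \<le> N)"

section \<open>The free product of pointed metric spaces\<close>

definition free_words :: "'a set \<Rightarrow> 'a \<Rightarrow> 'b set \<Rightarrow> 'b \<Rightarrow> ('a + 'b) list set" where
  "free_words X x0 Y y0 =
     {z \<in> lists ((X - {x0}) <+> (Y - {y0})). successively (\<lambda>a b. isl a \<noteq> isl b) z}"

definition free_norm ::
    "('a \<Rightarrow> 'a \<Rightarrow> real) \<Rightarrow> 'a \<Rightarrow> ('b \<Rightarrow> 'b \<Rightarrow> real) \<Rightarrow> 'b \<Rightarrow> ('a + 'b) list \<Rightarrow> real" where
  "free_norm dX x0 dY y0 z = sum_list (map (case_sum (\<lambda>x. dX x x0) (\<lambda>y. dY y y0)) z)"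

text \<open>
  Let \<open>u\<close> be the longest common beginning of \<open>z = u v\<close> and \<open>z' = u v'\<close>. If \<open>v\<close> and \<open>v'\<close> do not
  start with letters from the same factor, the distance is the sum of the norms of \<open>v\<close> and \<open>v'\<close>.
  If they start with distinct letters \<open>x\<close> and \<open>x'\<close> from the same factor, then both words continue
  inside one copy of that factor, and these two letters contribute their distance in the factor.
  This makes every copy of \<open>X\<close> and \<open>Y\<close> isometrically embedded, and for groups with left invariant
  metrics it gives the left invariant metric of the norm on the free product.

  The sum of the norms cannot be meant in the second case as well. It would replace the metric of
  each factor by \<open>d(x, x0) + d(x', x0)\<close>, so the words would be the vertices of a weighted
  tree, of asymptotic dimension at most \<open>1\<close> whatever the dimension of the factors. For
  \<open>X = \<int>\<close> and \<open>Y\<close> a point it would even have asymptotic dimension \<open>0\<close>.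
\<close>

definition free_dist ::
    "('a \<Rightarrow> 'a \<Rightarrow> real) \<Rightarrow> 'a \<Rightarrow> ('b \<Rightarrow> 'b \<Rightarrow> real) \<Rightarrow> 'b \<Rightarrow>
     ('a + 'b) list \<Rightarrow> ('a + 'b) list \<Rightarrow> real" where
  "free_dist dX x0 dY y0 z z' =
     (let u = longest_common_prefix z z';
          v = drop (length u) z;
          v' = drop (length u) z';
          nrm = free_norm dX x0 dY y0
      in case (v, v') of
           (Inl x # w, Inl x' # w') \<Rightarrow> dX x x' + nrm w + nrm w'
         | (Inr y # w, Inr y' # w') \<Rightarrow> dY y y' + nrm w + nrm w'
         | _ \<Rightarrow> nrm v + nrm v')"

definition letter_dist ::
    "('a \<Rightarrow> 'a \<Rightarrow> real) \<Rightarrow> 'a \<Rightarrow> ('b \<Rightarrow> 'b \<Rightarrow> real) \<Rightarrow> 'b \<Rightarrow> 'a + 'b \<Rightarrow> 'a + 'b \<Rightarrow> real" where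
  "letter_dist dX x0 dY y0 a b =
     (case (a, b) of
        (Inl x, Inl x') \<Rightarrow> dX x x'
      | (Inr y, Inr y') \<Rightarrow> dY y y'
      | (Inl x, Inr y) \<Rightarrow> dX x x0 + dY y y0
      | (Inr y, Inl x) \<Rightarrow> dY y y0 + dX x x0)"

lemma free_norm_Nil [simp]: "free_norm dX x0 dY y0 [] = 0"
  by (simp add: free_norm_def)

lemma free_norm_Cons [simp]:
  "free_norm dX x0 dY y0 (a # v) =
     case_sum (\<lambda>x. dX x x0) (\<lambda>y. dY y y0) a + free_norm dX x0 dY y0 v"
  by (simp add: free_norm_def)

lemma free_dist_Nil_left [simp]: "free_dist dX x0 dY y0 [] z = free_norm dX x0 dY y0 z"
  by (simp add: free_dist_def)

lemma free_dist_Nil_right [simp]: "free_dist dX x0 dY y0 z [] = free_norm dX x0 dY y0 z"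
  by (cases z) (auto simp: free_dist_def Let_def split: sum.split)

lemma free_dist_Cons_Cons [simp]:
  "free_dist dX x0 dY y0 (a # v) (b # w) =
     (if a = b then free_dist dX x0 dY y0 v w
      else letter_dist dX x0 dY y0 a b + free_norm dX x0 dY y0 v + free_norm dX x0 dY y0 w)"
proof (cases "a = b")
  case True
  then have "longest_common_prefix (a # v) (b # w) = a # longest_common_prefix v w"
    by simp
  with True show ?thesis
    unfolding free_dist_def Let_def
    by (simp only: list.size drop_Suc_Cons add_Suc_right add_0_right if_True simp_thms)
next
  case False
  then show ?thesis
    by (auto simp: free_dist_def letter_dist_def Let_def split: sum.split)
qed

locale pointed_pair =
  X: Metric_space X dX + Y: Metric_space Y dY
  for X :: "'a set" and dX and Y :: "'b set" and dY +
  fixes x0 y0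
  assumes base: "x0 \<in> X" "y0 \<in> Y"
begin

abbreviation "alph \<equiv> (X - {x0}) <+> (Y - {y0})"
abbreviation "nrm \<equiv> free_norm dX x0 dY y0"
abbreviation "dst \<equiv> free_dist dX x0 dY y0"
abbreviation "ld \<equiv> letter_dist dX x0 dY y0"
abbreviation "ln1 \<equiv> case_sum (\<lambda>x. dX x x0) (\<lambda>y. dY y y0)"

lemma letter_pos:
  assumes "a \<in> alph"
  shows "ln1 a > 0"
  using assms base by (auto simp: less_le)

lemma nrm_nonneg: "nrm v \<ge> 0"
  by (induction v) (auto split: sum.split)

lemma ld_nonneg: "ld a b \<ge> 0"
  by (auto simp: letter_dist_def split: sum.splits)

lemma ld_sym: "ld a b = ld b a"
  by (auto simp: letter_dist_def X.commute Y.commute split: sum.splits)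

lemma ld_zero:
  assumes "a \<in> alph" "b \<in> alph" "a \<noteq> b"
  shows "ld a b > 0"
proof (cases "isl a = isl b")
  case True
  with assms show ?thesis by (auto simp: letter_dist_def less_le)
next
  case False
  then have "ld a b = ln1 a + ln1 b"
    by (cases a; cases b; simp add: letter_dist_def)
  then show ?thesis using letter_pos[OF assms(1)] letter_pos[OF assms(2)] by linarith
qed

lemma factor_triangle:
  "x \<in> X \<Longrightarrow> x' \<in> X \<Longrightarrow> dX x x' \<le> dX x x0 + dX x' x0"
  "y \<in> Y \<Longrightarrow> y' \<in> Y \<Longrightarrow> dY y y' \<le> dY y y0 + dY y' y0"
  using X.triangle[of x x0 x'] Y.triangle[of y y0 y'] base
  by (simp_all add: X.commute Y.commute)

lemma ld_le: "a \<in> alph \<Longrightarrow> b \<in> alph \<Longrightarrow> ld a b \<le> ln1 a + ln1 b"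
  by (auto simp: letter_dist_def intro: factor_triangle)

lemma ln1_le: "a \<in> alph \<Longrightarrow> b \<in> alph \<Longrightarrow> ln1 a \<le> ld a b + ln1 b"
  using base by (auto simp: letter_dist_def intro: X.triangle Y.triangle)

lemma letter_nonneg: "0 \<le> ln1 a"
  by (auto split: sum.split)

lemma ld_triangle:
  assumes "a \<in> alph" "b \<in> alph" "c \<in> alph"
  shows "ld a c \<le> ld a b + ld b c"
proof (cases "isl a = isl b")
  case ab: True
  show ?thesis
  proof (cases "isl b = isl c")
    case True
    with ab assms show ?thesis
      by (auto simp: letter_dist_def intro: X.triangle Y.triangle)
  next
    case False
    with ab have "ld a c = ln1 a + ln1 c" "ld b c = ln1 b + ln1 c"
      by (cases a; cases b; cases c; simp add: letter_dist_def)+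
    then show ?thesis using ln1_le[OF assms(1,2)] by simp
  qed
next
  case ab: False
  then have 1: "ld a b = ln1 a + ln1 b"
    by (cases a; cases b; simp add: letter_dist_def)
  show ?thesis
  proof (cases "isl b = isl c")
    case True
    with ab have "ld a c = ln1 a + ln1 c"
      by (cases a; cases b; cases c; simp add: letter_dist_def)
    then show ?thesis using ln1_le[OF assms(3,2)] 1 by (simp add: ld_sym)
  next
    case False
    then have "ld b c = ln1 b + ln1 c"
      by (cases b; cases c; simp add: letter_dist_def)
    then show ?thesis
      using ld_le[OF assms(1,3)] 1 letter_nonneg[of b] by linarith
  qed
qed

lemma dst_sym: "dst z w = dst w z"
  by (induction z w rule: list_induct2') (auto simp: ld_sym)

lemma nrm_pos: "z \<in> lists alph \<Longrightarrow> z \<noteq> [] \<Longrightarrow> nrm z > 0"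
  using letter_pos[of "hd z"] nrm_nonneg[of "tl z"] by (cases z) simp_all

lemma dst_zero: "z \<in> lists alph \<Longrightarrow> w \<in> lists alph \<Longrightarrow> dst z w = 0 \<longleftrightarrow> z = w"
proof (induction z w rule: list_induct2')
  case 1
  then show ?case by simp
next
  case (2 x xs)
  then show ?case using nrm_pos[of "x # xs"] by (simp del: free_norm_Cons)
next
  case (3 y ys)
  then show ?case using nrm_pos[of "y # ys"] by (simp del: free_norm_Cons)
next
  case (4 a v b w)
  then have ab: "a \<in> alph" "b \<in> alph" and vw: "v \<in> lists alph" "w \<in> lists alph" by simp_all
  show ?case
  proof (cases "a = b")
    case True
    then show ?thesis using "4.IH"[OF vw] by simp
  next
    case False
    then show ?thesis
      using ld_zero[OF ab False] nrm_nonneg[of v] nrm_nonneg[of w] by simp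
  qed
qed

lemma dst_le: "z \<in> lists alph \<Longrightarrow> w \<in> lists alph \<Longrightarrow> dst z w \<le> nrm z + nrm w"
proof (induction z w rule: list_induct2')
  case (4 a v b w)
  then have ab: "a \<in> alph" "b \<in> alph" and vw: "v \<in> lists alph" "w \<in> lists alph" by simp_all
  show ?case
    using "4.IH"[OF vw] ld_le[OF ab] letter_nonneg[of a] letter_nonneg[of b] by simp
qed simp_all

lemma nrm_le: "z \<in> lists alph \<Longrightarrow> w \<in> lists alph \<Longrightarrow> nrm z \<le> dst z w + nrm w"
proof (induction z w rule: list_induct2')
  case 1
  then show ?case by simp
next
  case (2 x xs)
  then show ?case by simp
next
  case (3 y ys)
  then show ?case using nrm_nonneg[of "y # ys"] by (simp del: free_norm_Cons)
next
  case (4 a v b w)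
  then have ab: "a \<in> alph" "b \<in> alph" and vw: "v \<in> lists alph" "w \<in> lists alph" by simp_all
  show ?case
    using "4.IH"[OF vw] ln1_le[OF ab] nrm_nonneg[of w] by simp
qed

lemma dst_triangle:
  "z \<in> lists alph \<Longrightarrow> w \<in> lists alph \<Longrightarrow> t \<in> lists alph \<Longrightarrow> dst z t \<le> dst z w + dst w t"
proof (induction z arbitrary: w t)
  case Nil
  then show ?case using nrm_le[of t w] by (simp add: dst_sym)
next
  case (Cons a z)
  show ?case
  proof (cases "w = [] \<or> t = []")
    case True
    then show ?thesis
      using Cons.prems dst_le[of "a # z" t] nrm_le[of "a # z" w] by auto
  next
    case False
    then obtain b w' c t' where wt: "w = b # w'" "t = c # t'"
      by (meson list.exhaust)
    have m: "a \<in> alph" "b \<in> alph" "c \<in> alph" "z \<in> lists alph" "w' \<in> lists alph" "t' \<in> lists alph"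
      using Cons.prems wt by auto
    consider "a = b" "b = c" | "a = b" "b \<noteq> c" | "a \<noteq> b" "b = c" | "a \<noteq> b" "b \<noteq> c" "a = c"
      | "a \<noteq> b" "b \<noteq> c" "a \<noteq> c" by blast
    then show ?thesis
    proof cases
      case 1
      then show ?thesis using Cons.IH[OF m(4-6)] wt by simp
    next
      case 2
      then show ?thesis using nrm_le[OF m(4,5)] wt by simp
    next
      case 3
      then show ?thesis using nrm_le[OF m(6,5)] wt by (simp add: dst_sym)
    next
      case 4
      then show ?thesis
        using dst_le[OF m(4,6)] nrm_nonneg[of w'] ld_nonneg[of a b] ld_nonneg[of b c] wt by simp
    next
      case 5
      then show ?thesis
        using ld_triangle[OF m(1-3)] nrm_nonneg[of w'] wt by simp
    qed
  qed
qed

end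

lemma Metric_space_free_words:
  assumes "Metric_space X dX" "Metric_space Y dY" "x0 \<in> X" "y0 \<in> Y"
  shows "Metric_space (free_words X x0 Y y0) (free_dist dX x0 dY y0)"
proof -
  interpret pointed_pair X dX Y dY x0 y0
    using assms by (simp add: pointed_pair_def pointed_pair_axioms_def)
  have nonneg: "0 \<le> dst z w" for z w
  proof (induction z w rule: list_induct2')
    case (4 a v b w)
    then show ?case by (simp add: nrm_nonneg ld_nonneg add_nonneg_nonneg del: free_norm_Cons)
  qed (simp_all add: nrm_nonneg del: free_norm_Cons)
  show ?thesis
    using nonneg dst_sym dst_zero dst_triangle
    by unfold_locales (auto simp: free_words_def)
qed

end

(* Asymptotic dimension at most n means that for every D there is a colouring with n + 1 colours whose
   D-components of each colour are uniformly bounded; these components are given by labels.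

   Colour the words by reading them from left to right. Near a root v, initially the empty word, the
   colour depends only on the distance from v: the words vw with norm of w at most D get the colour j
   of the root, and those with norm between D and 2D get another colour, which exists since n > 0.
   Each letter a that leaves this region makes the word read so far a new root, with the colour of a
   in its factor. Since the shell of width D around a root separates, a component of colour i meets
   only the shell of one root v and the inner parts of the children of v. Inside one copy of a factor
   it is controlled by a component of that factor; if it leaves this copy, then it contains points
   near v. Hence it is bounded in terms of D and the bound R for the factors. Conversely, X embeds
   isometrically into the space of words. *)
theory Submission
  imports Defs
begin

section \<open>Asymptotic dimension through coloured labellings\<close>

text \<open>The sets of colour \<open>i\<close> are the sets of constant label among the points of colour \<open>i\<close>.\<close>

definition coloured_labelling ::
    "'a set \<Rightarrow> ('a \<Rightarrow> 'a \<Rightarrow> real) \<Rightarrow> nat \<Rightarrow> real \<Rightarrow> real \<Rightarrow> ('a \<Rightarrow> nat) \<Rightarrow> ('a \<Rightarrow> 'l) \<Rightarrow> bool" where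
  "coloured_labelling M d n D R c \<kappa> \<longleftrightarrow>
     (\<forall>p\<in>M. c p \<le> n) \<and>
     (\<forall>p\<in>M. \<forall>q\<in>M. c p = c q \<longrightarrow> d p q \<le> D \<longrightarrow> \<kappa> p = \<kappa> q) \<and>
     (\<forall>p\<in>M. \<forall>q\<in>M. c p = c q \<longrightarrow> \<kappa> p = \<kappa> q \<longrightarrow> d p q \<le> R)"

lemma coloured_labelling_mono:
  assumes "coloured_labelling M d m D R c \<kappa>" "m \<le> n" "R \<le> R'"
  shows "coloured_labelling M d n D R' c \<kappa>"
  using assms unfolding coloured_labelling_def by (fast elim: order_trans)

lemma coloured_labelling_isometry:
  assumes "coloured_labelling N e n D R c \<kappa>" "f ` M \<subseteq> N"
    and "\<And>p q. p \<in> M \<Longrightarrow> q \<in> M \<Longrightarrow> e (f p) (f q) = d p q"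
  shows "coloured_labelling M d n D R (c \<circ> f) (\<kappa> \<circ> f)"
proof -
  have "f p \<in> N" if "p \<in> M" for p using assms(2) that by blast
  then show ?thesis
    using assms(1) unfolding coloured_labelling_def by (simp flip: assms(3))
qed

lemma asdim_leI_labelling:
  assumes "\<And>D. D > 0 \<Longrightarrow> \<exists>R c (\<kappa> :: 'a \<Rightarrow> 'l). coloured_labelling M d n D R c \<kappa>"
  shows "asdim_le M d n"
  unfolding asdim_le_def
proof (intro allI impI)
  fix D :: real
  assume "D > 0"
  \<comment> \<open>Different labels give distances above the parameter, but an infimum loses
    strictness; the slack 1 keeps \<open>set_distance\<close> above \<open>D\<close>.\<close>
  then obtain R c and \<kappa> :: "'a \<Rightarrow> 'l" where cl: "coloured_labelling M d n (D + 1) R c \<kappa>"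
    using assms[of "D + 1"] by auto
  define U where "U i = (\<lambda>l. {p \<in> M. c p = i \<and> \<kappa> p = l}) ` UNIV" for i
  have "disjoint_family_by d D (U i)" for i
    unfolding disjoint_family_by_def
  proof (intro ballI impI)
    fix A B
    assume "A \<in> U i" "B \<in> U i" "A \<noteq> B"
    then obtain k l where A: "A = {p \<in> M. c p = i \<and> \<kappa> p = k}"
      and B: "B = {p \<in> M. c p = i \<and> \<kappa> p = l}" and "k \<noteq> l"
      unfolding U_def by blast
    have "D + 1 \<le> d p q" if "p \<in> A" "q \<in> B" for p q
    proof (rule ccontr)
      assume "\<not> D + 1 \<le> d p q"
      then have "\<kappa> p = \<kappa> q"
        using cl that A B unfolding coloured_labelling_def by auto
      then show False using that A B \<open>k \<noteq> l\<close> by simp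
    qed
    then have "ereal (D + 1) \<le> set_distance d A B"
      unfolding set_distance_def by (intro INF_greatest) simp
    moreover have "ereal D < ereal (D + 1)" by simp
    ultimately show "set_distance d A B > ereal D" by (rule less_le_trans[rotated])
  qed
  moreover have "uniformly_bounded_family d (U i)" for i
    using cl unfolding uniformly_bounded_family_def coloured_labelling_def U_def
    by (intro exI[of _ R]) auto
  moreover have "U i \<subseteq> Pow M" for i
    unfolding U_def by auto
  moreover have "M \<subseteq> (\<Union>i\<le>n. \<Union>(U i))"
    using cl unfolding coloured_labelling_def U_def by auto
  ultimately show "\<exists>\<U> :: nat \<Rightarrow> 'a set set.
        (\<forall>i\<le>n. \<U> i \<subseteq> Pow M \<and> uniformly_bounded_family d (\<U> i) \<and>
               disjoint_family_by d D (\<U> i)) \<and>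
        M \<subseteq> (\<Union>i\<le>n. \<Union>(\<U> i))"
    by blast
qed

text \<open>The label of a point is a chosen member of the cover that contains it; the bound is the
  maximum over the finitely many colours.\<close>

lemma asdim_leE_labelling:
  assumes "asdim_le M d n" "D > 0"
  obtains R c and \<kappa> :: "'a \<Rightarrow> 'a set" where "coloured_labelling M d n D R c \<kappa>"
proof -
  obtain U where U: "\<And>i. i \<le> n \<Longrightarrow> uniformly_bounded_family d (U i) \<and> disjoint_family_by d D (U i)"
    and cover: "M \<subseteq> (\<Union>i\<le>n. \<Union>(U i))"
    using assms unfolding asdim_le_def by meson
  obtain r where r: "\<And>i A a b. i \<le> n \<Longrightarrow> A \<in> U i \<Longrightarrow> a \<in> A \<Longrightarrow> b \<in> A \<Longrightarrow> d a b \<le> r i"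
    using U unfolding uniformly_bounded_family_def by metis
  define R where "R = Max (r ` {..n})"
  have R: "r i \<le> R" if "i \<le> n" for i
    unfolding R_def using that by simp
  have "\<forall>p. \<exists>i A. p \<in> M \<longrightarrow> i \<le> n \<and> A \<in> U i \<and> p \<in> A"
    using cover by blast
  then obtain c \<kappa> where c: "\<And>p. p \<in> M \<Longrightarrow> c p \<le> n \<and> \<kappa> p \<in> U (c p) \<and> p \<in> \<kappa> p"
    by metis
  have "\<kappa> p = \<kappa> q" if "p \<in> M" "q \<in> M" "c p = c q" "d p q \<le> D" for p q
  proof (rule ccontr)
    assume "\<kappa> p \<noteq> \<kappa> q"
    then have "ereal D < set_distance d (\<kappa> p) (\<kappa> q)"
      using U[of "c p"] c[OF that(1)] c[OF that(2)] that(3) unfolding disjoint_family_by_def by auto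
    also have "\<dots> \<le> ereal (d p q)"
      unfolding set_distance_def using c that by (meson INF_lower2 order_refl)
    finally show False using that(4) by simp
  qed
  moreover have "d p q \<le> R" if "p \<in> M" "q \<in> M" "c p = c q" "\<kappa> p = \<kappa> q" for p q
    using r[of "c p" "\<kappa> p" p q] R[of "c p"] c[OF that(1)] c[OF that(2)] that by auto
  ultimately have "coloured_labelling M d n D R c \<kappa>"
    unfolding coloured_labelling_def using c by blast
  then show thesis by (rule that)
qed

lemma asdim_le_mono:
  assumes "asdim_le M d m" "m \<le> n"
  shows "asdim_le M d n"
proof (rule asdim_leI_labelling)
  fix D :: real
  assume "D > 0"
  then obtain R c and \<kappa> :: "'a \<Rightarrow> 'a set" where "coloured_labelling M d m D R c \<kappa>"
    using assms(1) asdim_leE_labelling by blast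
  then show "\<exists>R c (\<kappa> :: 'a \<Rightarrow> 'a set). coloured_labelling M d n D R c \<kappa>"
    using coloured_labelling_mono[OF _ assms(2) order_refl] by blast
qed

lemma asdim_le_isometry:
  fixes M :: "'a set" and N :: "'b set"
  assumes "asdim_le N e n" "f ` M \<subseteq> N"
    and "\<And>p q. p \<in> M \<Longrightarrow> q \<in> M \<Longrightarrow> e (f p) (f q) = d p q"
  shows "asdim_le M d n"
proof (rule asdim_leI_labelling)
  fix D :: real
  assume "D > 0"
  then obtain R c and \<kappa> :: "'b \<Rightarrow> 'b set" where "coloured_labelling N e n D R c \<kappa>"
    using assms(1) asdim_leE_labelling by blast
  from coloured_labelling_isometry[OF this assms(2,3)]
  show "\<exists>R c (\<kappa> :: 'a \<Rightarrow> 'b set). coloured_labelling M d n D R c \<kappa>"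
    by blast
qed

text \<open>The empty infimum is \<infinity>, a nonempty one is attained since \<open>enat\<close>
  is well ordered, and \<open>asdim_le\<close> is upward closed.\<close>

lemma asdim_le_enat_iff: "asdim M d \<le> enat n \<longleftrightarrow> asdim_le M d n"
proof
  assume le: "asdim M d \<le> enat n"
  then have "enat ` {n. asdim_le M d n} \<noteq> {}"
    unfolding asdim_def by (metis Inf_enat_def enat_ord_code(5) infinity_ileE)
  then have "asdim M d \<in> enat ` {n. asdim_le M d n}"
    unfolding asdim_def by (meson ex_in_conv wellorder_InfI)
  then show "asdim_le M d n"
    using le asdim_le_mono by auto
next
  assume "asdim_le M d n"
  then show "asdim M d \<le> enat n"
    unfolding asdim_def by (intro Inf_lower) simp
qed

section \<open>The colouring of the words\<close>

text \<open>Allows two words to be read from one common state up to where they branch.\<close>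

lemma common_beginning:
  "\<exists>u v w. p = u @ v \<and> q = u @ w \<and> (v = [] \<or> w = [] \<or> hd v \<noteq> hd w)"
proof (induction p q rule: list_induct2')
  case (4 a p b q)
  then obtain u v w where uvw: "p = u @ v" "q = u @ w" "v = [] \<or> w = [] \<or> hd v \<noteq> hd w" by blast
  show ?case
  proof (cases "a = b")
    case True
    then have "a # p = (a # u) @ v" "b # q = (a # u) @ w" using uvw by simp_all
    then show ?thesis using uvw by blast
  next
    case False
    then show ?thesis by (metis append_Nil list.sel(1))
  qed
qed auto

context pointed_pair
begin

lemma dst_append [simp]: "dst (z @ v) (z @ w) = dst v w"
  by (induction z) auto

lemma dst_append_left [simp]: "dst (z @ v) z = nrm v"
  using dst_append[of z v "[]"] by simp

lemma nrm_append [simp]: "nrm (v @ w) = nrm v + nrm w"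
  by (simp add: free_norm_def)

end

type_synonym ('c, 'm) state =
  "'c list \<times> 'c list \<times> nat \<times> real \<times> 'c list \<times> 'm option"

locale coloured_pair = pointed_pair X dX Y dY x0 y0
  for X :: "'a set" and dX and Y :: "'b set" and dY and x0 y0 +
  fixes c :: "'a + 'b \<Rightarrow> nat" and \<kappa> :: "'a + 'b \<Rightarrow> 'l" and n :: nat and D R :: real
  assumes D: "D > 0" and R: "R \<ge> 0" and n: "n > 0"
    and c_le: "a \<in> alph \<Longrightarrow> c a \<le> n"
    and close: "a \<in> alph \<Longrightarrow> b \<in> alph \<Longrightarrow> isl a = isl b \<Longrightarrow> c a = c b \<Longrightarrow> ld a b \<le> D \<Longrightarrow> \<kappa> a = \<kappa> b"
    and bounded: "a \<in> alph \<Longrightarrow> b \<in> alph \<Longrightarrow> c a = c b \<Longrightarrow> \<kappa> a = \<kappa> b \<Longrightarrow> ld a b \<le> R"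
begin

text \<open>Depends only on the component of \<open>a\<close>, so it cannot split one. The radius is
  2 D, the most a letter that stays in the region of a root can have, plus one jump of length
  D.\<close>

definition near :: "'a + 'b \<Rightarrow> bool" where
  "near a \<longleftrightarrow> (\<exists>b\<in>alph. c b = c a \<and> \<kappa> b = \<kappa> a \<and> ln1 b \<le> 3 * D)"

text \<open>
  A state \<open>(z, v, j, t, l)\<close> consists of the word \<open>z\<close> read so far, its root \<open>v\<close>, the colour \<open>j\<close> of
  the root, the distance \<open>t\<close> of \<open>z\<close> from the root, and the label \<open>l\<close> for the inner part around the
  root. The label \<open>(v, None)\<close> belongs to the shell around \<open>v\<close> and to the components that may meet
  it, and \<open>(z, Some k)\<close> to the remaining components in the copy of a factor based at \<open>z\<close>.
\<close>

fun step :: "('a + 'b, 'l) state \<Rightarrow> 'a + 'b \<Rightarrow> ('a + 'b, 'l) state" where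
  "step (z, v, j, t, l) a =
     (if t + ln1 a \<le> 2 * D then (z @ [a], v, j, t + ln1 a, l)
      else (z @ [a], z @ [a], c a, 0, if near a then (v, None) else (z, Some (\<kappa> a))))"

abbreviation "run \<equiv> foldl step"

text \<open>The empty word has no parent root, so its inner part is labelled as if it were its own
  parent.\<close>

abbreviation start :: "('a + 'b, 'l) state" where
  "start \<equiv> ([], [], 0, 0, [], None)"

fun colour :: "('a + 'b, 'l) state \<Rightarrow> nat" where
  "colour (z, v, j, t, l) = (if t \<le> D then j else if j = 0 then 1 else 0)"

fun label :: "('a + 'b, 'l) state \<Rightarrow> ('a + 'b) list \<times> 'l option" where
  "label (z, v, j, t, l) = (if t \<le> D then l else (v, None))"

fun inv :: "('a + 'b, 'l) state \<Rightarrow> bool" where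
  "inv (z, v, j, t, l) \<longleftrightarrow>
     v \<in> lists alph \<and> (\<exists>w\<in>lists alph. z = v @ w \<and> nrm w = t) \<and> t \<le> 2 * D \<and> j \<le> n \<and>
     (\<forall>v'. l = (v', None) \<longrightarrow> v' \<in> lists alph \<and> dst v v' \<le> R + 5 * D) \<and>
     (\<forall>z' k. l = (z', Some k) \<longrightarrow> (\<exists>a\<in>alph. v = z' @ [a] \<and> \<kappa> a = k \<and> c a = j))"

lemma near_ln1_le: "a \<in> alph \<Longrightarrow> near a \<Longrightarrow> ln1 a \<le> R + 3 * D"
  unfolding near_def using bounded[of a] ln1_le[of a] by fastforce

section \<open>The invariant along a run\<close>

lemma inv_step:
  assumes "inv st" "a \<in> alph"
  shows "inv (step st a)"
proof -
  obtain z v j t l where st: "st = (z, v, j, t, l)" by (metis prod.collapse)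
  from assms(1) obtain w where w: "w \<in> lists alph" "z = v @ w" "nrm w = t" and v: "v \<in> lists alph"
    and t: "t \<le> 2 * D" unfolding st by auto
  show ?thesis
  proof (cases "t + ln1 a \<le> 2 * D")
    case True
    have "w @ [a] \<in> lists alph \<and> z @ [a] = v @ w @ [a] \<and> nrm (w @ [a]) = t + ln1 a"
      using w assms(2) by simp
    then have "\<exists>w\<in>lists alph. z @ [a] = v @ w \<and> nrm w = t + ln1 a" by blast
    then show ?thesis using True assms(1) unfolding st by simp
  next
    case False
    \<comment> \<open>At most 2 D from the old root to \<open>z\<close>, and at most R + 3 D for the
      near letter.\<close>
    have "dst (z @ [a]) v \<le> R + 5 * D" if "near a"
      using near_ln1_le[OF assms(2) that] w t by simp
    then show ?thesis using False w v c_le assms(2) D unfolding st by auto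
  qed
qed

lemma inv_run: "inv st \<Longrightarrow> z \<in> lists alph \<Longrightarrow> inv (run st z)"
proof (induction z arbitrary: st)
  case (Cons a z)
  then show ?case using inv_step[of st a] by (simp del: inv.simps step.simps)
qed simp

lemma inv_start: "inv start"
  using D R by simp

lemma fst_run: "fst (run st z) = fst st @ z"
proof (induction z arbitrary: st)
  case (Cons a z)
  obtain u v j t l where "st = (u, v, j, t, l)" by (metis prod.collapse)
  then show ?case using Cons by simp
qed simp

lemma run_cases:
  assumes "z \<in> lists alph"
  obtains v j t l where "run start z = (z, v, j, t, l)" "inv (z, v, j, t, l)"
proof -
  obtain z' v j t l where st: "run start z = (z', v, j, t, l)" by (metis prod.collapse)
  then have "z' = z" using fst_run[of start z] by simp
  then show thesis using that st inv_run[OF inv_start assms] by simp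
qed

section \<open>Number of colours and boundedness of components\<close>

lemma colour_le:
  assumes "z \<in> lists alph"
  shows "colour (run start z) \<le> n"
proof -
  obtain v j t l where "run start z = (z, v, j, t, l)" "inv (z, v, j, t, l)"
    using run_cases[OF assms] by blast
  then show ?thesis using n by simp
qed

text \<open>A shell point is within 2 D of its root, which is \<open>v'\<close>. An inner point is
  within D of its own root, which the invariant puts within R + 5 D of \<open>v'\<close>.\<close>

lemma dst_label_None:
  assumes z: "z \<in> lists alph" and l: "label (run start z) = (v', None)"
  shows "v' \<in> lists alph" "dst z v' \<le> R + 6 * D"
proof -
  obtain v j t l where st: "run start z = (z, v, j, t, l)" and "inv (z, v, j, t, l)"
    using run_cases[OF z] by blast
  then obtain w where v: "v \<in> lists alph" and w: "z = v @ w" "nrm w = t" and t: "t \<le> 2 * D"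
    and l': "l = (v', None) \<Longrightarrow> v' \<in> lists alph \<and> dst v v' \<le> R + 5 * D"
    by auto
  show "v' \<in> lists alph" using l st l' v by (simp split: if_splits)
  then show "dst z v' \<le> R + 6 * D"
    using l st l' v w t R D dst_triangle[OF z v, of v'] by (auto split: if_splits)
qed

text \<open>With \<open>None\<close>, both words are within R + 6 D of the same word. With
  \<open>Some\<close>, they branch off at one word by letters of one component, followed by tails of
  norm at most D.\<close>

lemma bounded_words:
  assumes p: "p \<in> lists alph" and q: "q \<in> lists alph"
    and col: "colour (run start p) = colour (run start q)"
    and lab: "label (run start p) = label (run start q)"
  shows "dst p q \<le> 2 * R + 12 * D"
proof -
  obtain z k where l: "label (run start p) = (z, k)" by fastforce
  show ?thesis
  proof (cases k)
    case None
    then show ?thesis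
      using dst_label_None[OF p, of z] dst_label_None[OF q, of z] l lab dst_triangle[OF p _ q, of z]
      by (simp add: dst_sym)
  next
    case (Some k')
    have *: "\<exists>a\<in>alph. \<exists>w\<in>lists alph. r = z @ a # w \<and> nrm w \<le> D \<and> \<kappa> a = k' \<and> c a = colour (run start r)"
      if r: "r \<in> lists alph" and "label (run start r) = (z, Some k')" for r
    proof -
      obtain v j t l where "run start r = (r, v, j, t, l)" "inv (r, v, j, t, l)"
        using run_cases[OF r] by blast
      then show ?thesis using that(2) by (auto split: if_splits)
    qed
    obtain a v where a: "a \<in> alph" "v \<in> lists alph" "p = z @ a # v" "nrm v \<le> D" "\<kappa> a = k'"
      "c a = colour (run start p)"
      using *[OF p] l Some by blast
    obtain b w where b: "b \<in> alph" "w \<in> lists alph" "q = z @ b # w" "nrm w \<le> D" "\<kappa> b = k'"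
      "c b = colour (run start q)"
      using *[OF q] l lab Some by metis
    have "ld a b \<le> R" using bounded a b col by simp
    moreover have "dst v w \<le> nrm v + nrm w" using dst_le a b by blast
    ultimately show ?thesis using a b R D by simp
  qed
qed

section \<open>Labels of nearby words of equal colour\<close>

lemma run_stay: "t + nrm w \<le> 2 * D \<Longrightarrow> run (z, v, j, t, l) w = (z @ w, v, j, t + nrm w, l)"
proof (induction w arbitrary: z t)
  case (Cons a w)
  then show ?case using nrm_nonneg[of w] by (simp add: add.assoc)
qed simp

text \<open>
  The hypotheses ensure that the word crosses from the region of one root to that of another at most
  once, and that then the component meets the shell around the old root.
\<close>

lemma run_short:
  assumes "w \<in> lists alph" "t \<le> 2 * D" "nrm (tl w) \<le> D" "w \<noteq> [] \<Longrightarrow> ln1 (hd w) \<le> 3 * D"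
  shows "run (z, v, j, t, l) w = (z @ w, v, j, t + nrm w, l) \<and> t + nrm w \<le> 2 * D \<or>
    label (run (z, v, j, t, l) w) = (v, None) \<and> t + nrm w > 2 * D"
  using assms
proof (induction w arbitrary: z t rule: list.induct)
  case (Cons a w)
  have w: "w \<in> lists alph" "a \<in> alph" "nrm w \<le> D" "ln1 a \<le> 3 * D" using Cons.prems by simp_all
  show ?case
  proof (cases "t + ln1 a \<le> 2 * D")
    case True
    have "nrm (tl w) \<le> D" "w \<noteq> [] \<Longrightarrow> ln1 (hd w) \<le> 3 * D"
      using w(3) D letter_nonneg[of "hd w"] nrm_nonneg[of "tl w"] by (cases w; simp)+
    from Cons.IH[OF w(1) True this, of "z @ [a]"] show ?thesis
      using True by (auto simp: add.assoc)
  next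
    case False
    have "near a" using w unfolding near_def by blast
    then have "step (z, v, j, t, l) a = (z @ [a], z @ [a], c a, 0, v, None)"
      using False by simp
    \<comment> \<open>The rest has norm at most D, so it stays in the inner part of the new root,
      which carries the label of the old shell.\<close>
    moreover have "run (z @ [a], z @ [a], c a, 0, v, None) w =
        (z @ [a] @ w, z @ [a], c a, nrm w, v, None)"
      using run_stay[of 0 w] w D by simp
    ultimately show ?thesis using w False nrm_nonneg[of w] by simp
  qed
qed auto

text \<open>If both first letters lie in one factor and leave the region, the labelling of that
  factor decides. Otherwise the first letters are short enough for \<open>run_short\<close>.\<close>

lemma close_suffixes:
  assumes w: "w \<in> lists alph" and w': "w' \<in> lists alph"
    and branch: "w = [] \<or> w' = [] \<or> hd w \<noteq> hd w'"
    and t: "0 \<le> t" "t \<le> 2 * D" and le: "dst w w' \<le> D"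
    and col: "colour (run (z, v, j, t, l) w) = colour (run (z, v, j, t, l) w')"
  shows "label (run (z, v, j, t, l) w) = label (run (z, v, j, t, l) w')"
proof (cases "\<exists>a u b u'. w = a # u \<and> w' = b # u' \<and> isl a = isl b \<and> t + ln1 a > 2 * D \<and> t + ln1 b > 2 * D")
  case True
  then obtain a u b u' where ab: "w = a # u" "w' = b # u'" "isl a = isl b"
    and out: "t + ln1 a > 2 * D" "t + ln1 b > 2 * D" by blast
  have "ld a b + nrm u + nrm u' \<le> D" using branch le ab by simp
  then have small: "nrm u \<le> D" "nrm u' \<le> D" "ld a b \<le> D"
    using ld_nonneg[of a b] nrm_nonneg[of u] nrm_nonneg[of u'] by linarith+
  have *: "run (z, v, j, t, l) (a # u) =
      (z @ a # u, z @ [a], c a, nrm u, if near a then (v, None) else (z, Some (\<kappa> a)))"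
    if "t + ln1 a > 2 * D" "nrm u \<le> D" for a u
    using that run_stay[of 0 u] D by simp
  \<comment> \<open>Both words end in the inner parts of their new roots, where the colour is that
    of the letter.\<close>
  have "c a = c b"
    using col ab *[OF out(1) small(1)] *[OF out(2) small(2)] small by simp
  moreover then have "\<kappa> a = \<kappa> b"
    using close[OF _ _ ab(3)] small w w' ab by simp
  moreover from calculation have "near a = near b"
    unfolding near_def by simp
  ultimately show ?thesis
    using ab *[OF out(1) small(1)] *[OF out(2) small(2)] small by (simp del: foldl_Cons)
next
  case False
  have short: "nrm (tl w) \<le> D \<and> (w \<noteq> [] \<longrightarrow> ln1 (hd w) \<le> 3 * D) \<and>
      nrm (tl w') \<le> D \<and> (w' \<noteq> [] \<longrightarrow> ln1 (hd w') \<le> 3 * D)"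
  proof (cases "w = [] \<or> w' = []")
    case True
    have "nrm (tl y) \<le> D \<and> (y \<noteq> [] \<longrightarrow> ln1 (hd y) \<le> 3 * D)" if "nrm y \<le> D" for y
      using that D letter_nonneg[of "hd y"] nrm_nonneg[of "tl y"] by (cases y) auto
    moreover have "nrm w \<le> D" "nrm w' \<le> D" using True le D by auto
    ultimately show ?thesis by blast
  next
    case ne: False
    then obtain a u b u' where ab: "w = a # u" "w' = b # u'" by (meson list.exhaust)
    have sum: "ld a b + nrm u + nrm u' \<le> D" using branch le ab by simp
    have in_alph: "a \<in> alph" "b \<in> alph" using w w' ab by auto
    have "ln1 a \<le> 3 * D \<and> ln1 b \<le> 3 * D"
    proof (cases "isl a = isl b")
      case True
      \<comment> \<open>The letter that stays has norm at most 2 D, and the norm of the other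
        differs from it by at most D.\<close>
      then have "t + ln1 a \<le> 2 * D \<or> t + ln1 b \<le> 2 * D" using False ab by auto
      then show ?thesis
        using ln1_le[OF in_alph] ln1_le[OF in_alph(2,1)] ld_sym[of a b] sum t
          nrm_nonneg[of u] nrm_nonneg[of u'] by linarith
    next
      case False
      then have "ld a b = ln1 a + ln1 b"
        by (cases a; cases b; simp add: letter_dist_def)
      then show ?thesis
        using sum D letter_nonneg[of a] letter_nonneg[of b] nrm_nonneg[of u] nrm_nonneg[of u'] by linarith
    qed
    then show ?thesis
      using ab sum ld_nonneg[of a b] nrm_nonneg[of u] nrm_nonneg[of u'] by simp
  qed
  \<comment> \<open>The shell has width D: if one word gets beyond 2 D, the other is beyond D, so
    both have label \<open>(v, None)\<close>. If both stay, equal colours put both in the inner part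
    or both in the shell.\<close>
  have diff: "nrm w \<le> D + nrm w'" "nrm w' \<le> D + nrm w"
    using nrm_le[OF w w'] nrm_le[OF w' w] le by (simp_all add: dst_sym)
  have "run (z, v, j, t, l) w = (z @ w, v, j, t + nrm w, l) \<and> t + nrm w \<le> 2 * D \<or>
      label (run (z, v, j, t, l) w) = (v, None) \<and> t + nrm w > 2 * D"
    using run_short[OF w t(2)] short by blast
  moreover have "run (z, v, j, t, l) w' = (z @ w', v, j, t + nrm w', l) \<and> t + nrm w' \<le> 2 * D \<or>
      label (run (z, v, j, t, l) w') = (v, None) \<and> t + nrm w' > 2 * D"
    using run_short[OF w' t(2)] short by blast
  ultimately show ?thesis
    using col diff by (elim disjE conjE) (auto split: if_splits)
qed

lemma close_words:
  assumes p: "p \<in> lists alph" and q: "q \<in> lists alph" and le: "dst p q \<le> D"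
    and col: "colour (run start p) = colour (run start q)"
  shows "label (run start p) = label (run start q)"
proof -
  obtain u w w' where uw: "p = u @ w" "q = u @ w'" "w = [] \<or> w' = [] \<or> hd w \<noteq> hd w'"
    using common_beginning by blast
  have words: "u \<in> lists alph" "w \<in> lists alph" "w' \<in> lists alph" using p q uw by auto
  obtain v j t l where st: "run start u = (u, v, j, t, l)" and i: "inv (u, v, j, t, l)"
    using run_cases[OF words(1)] by blast
  have "0 \<le> t" "t \<le> 2 * D" using i nrm_nonneg by auto
  then show ?thesis
    using close_suffixes[OF words(2,3) uw(3), of t u v j l] le col uw st by simp
qed

lemma labelling_words:
  "coloured_labelling (free_words X x0 Y y0) dst n D (2 * R + 12 * D)
     (\<lambda>z. colour (run start z)) (\<lambda>z. label (run start z))"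
  unfolding coloured_labelling_def free_words_def
  by (intro conjI ballI impI) (simp_all add: colour_le close_words bounded_words)

end

section \<open>The asymptotic dimension of the space of words\<close>

lemma asdim_le_free_words:
  fixes X :: "'a set" and Y :: "'b set"
  assumes mX: "Metric_space X dX" and mY: "Metric_space Y dY" and x0: "x0 \<in> X" and y0: "y0 \<in> Y"
    and aX: "asdim_le X dX n" and aY: "asdim_le Y dY n" and "n > 0"
  shows "asdim_le (free_words X x0 Y y0) (free_dist dX x0 dY y0) n"
proof (rule asdim_leI_labelling)
  fix D :: real
  assume D: "D > 0"
  obtain RX cX and kX :: "'a \<Rightarrow> 'a set" where X: "coloured_labelling X dX n D RX cX kX"
    using asdim_leE_labelling[OF aX D] by blast
  obtain RY cY and kY :: "'b \<Rightarrow> 'b set" where Y: "coloured_labelling Y dY n D RY cY kY"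
    using asdim_leE_labelling[OF aY D] by blast
  define R where "R = max 0 (max RX RY)"
  have X: "coloured_labelling X dX n D R cX kX" and Y: "coloured_labelling Y dY n D R cY kY"
    using coloured_labelling_mono[OF X order_refl] coloured_labelling_mono[OF Y order_refl] by (auto simp: R_def)
  \<comment> \<open>\<open>map_sum\<close> tags labels by factor, so letters of different factors
    never share one and \<open>bounded\<close> holds for all pairs of letters.\<close>
  interpret coloured_pair X dX Y dY x0 y0 "case_sum cX cY" "map_sum kX kY" n D R
  proof (intro coloured_pair.intro coloured_pair_axioms.intro)
    show "pointed_pair X dX Y dY x0 y0"
      using mX mY x0 y0 by (simp add: pointed_pair_def pointed_pair_axioms_def)
  qed (use D \<open>n > 0\<close> X Y in \<open>auto simp: R_def coloured_labelling_def letter_dist_def\<close>)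
  show "\<exists>R c (\<kappa> :: ('a + 'b) list \<Rightarrow> ('a + 'b) list \<times> ('a set + 'b set) option).
      coloured_labelling (free_words X x0 Y y0) (free_dist dX x0 dY y0) n D R c \<kappa>"
    using labelling_words by blast
qed

lemma asdim_le_factor:
  fixes X :: "'a set" and Y :: "'b set"
  assumes mX: "Metric_space X dX" and x0: "x0 \<in> X"
    and le: "asdim_le (free_words X x0 Y y0) (free_dist dX x0 dY y0) n"
  shows "asdim_le X dX n"
proof (rule asdim_le_isometry[OF le])
  interpret Metric_space X dX by (rule mX)
  \<comment> \<open>The base point is not a letter; it is identified with the empty word.\<close>
  let ?f = "\<lambda>x. if x = x0 then [] else [Inl x] :: ('a + 'b) list"
  show "?f ` X \<subseteq> free_words X x0 Y y0"
    by (auto simp: free_words_def)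
  show "free_dist dX x0 dY y0 (?f p) (?f q) = dX p q" if "p \<in> X" "q \<in> X" for p q
    using that x0 by (auto simp: letter_dist_def commute)
qed

theorem theorem5:
  fixes X :: "'a set" and dX :: "'a \<Rightarrow> 'a \<Rightarrow> real" and x0 :: 'a
    and Y :: "'b set" and dY :: "'b \<Rightarrow> 'b \<Rightarrow> real" and y0 :: 'b
    and n :: nat
  assumes "discrete_metric_space X dX" and "bounded_geometry X dX" and "x0 \<in> X"
    and "discrete_metric_space Y dY" and "bounded_geometry Y dY" and "y0 \<in> Y"
    and "asdim X dX = enat n" and "asdim Y dY \<le> enat n" and "n > 0"
  shows "asdim (free_words X x0 Y y0) (free_dist dX x0 dY y0) = enat n"
proof (rule antisym)
  let ?W = "free_words X x0 Y y0" and ?d = "free_dist dX x0 dY y0"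
  have mX: "Metric_space X dX" and mY: "Metric_space Y dY"
    using assms unfolding discrete_metric_space_def by auto
  have "asdim_le X dX n" "asdim_le Y dY n"
    using assms by (simp_all flip: asdim_le_enat_iff)
  then show le: "asdim ?W ?d \<le> enat n"
    unfolding asdim_le_enat_iff
    using asdim_le_free_words[OF mX mY \<open>x0 \<in> X\<close> \<open>y0 \<in> Y\<close>] \<open>n > 0\<close> by simp
  \<comment> \<open>The upper bound makes the value finite, so it can be transferred to
    \<open>X\<close> as a bound \<open>m\<close>.\<close>
  then obtain m where m: "asdim ?W ?d = enat m"
    by (metis enat_ile)
  then have "asdim_le ?W ?d m"
    by (simp flip: asdim_le_enat_iff)
  then have "asdim X dX \<le> enat m"
    unfolding asdim_le_enat_iff by (rule asdim_le_factor[OF mX \<open>x0 \<in> X\<close>])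
  then show "enat n \<le> asdim ?W ?d"
    using assms m by simp
qed

end
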